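(* Let $k\in[K]$ and $\boldsymbol{\delta}\in\Delta_k$. If $\boldsymbol{\delta}$ satisfies all four of the following properties, then $\boldsymbol{\delta}$ is a Pareto cut: 1. $T_k(\boldsymbol{\delta})>1$; 2. $\delta_1\le r_{i_{k,1}}$; 3. for all $\ell\in\{2,\ldots,L_k\}$, if $\delta_\ell<r_{i_{k,\ell}}$, then $\delta_\ell=\delta_{\ell+1}$; 4. $\delta_{T_k(\boldsymbol{\delta})}=\cdots=\delta_{L_k+1}$.
   Context: Notation: $[n]=\{1,\ldots,n\}$. There are products $[N+1]$, where product $N+1$ is the no-purchase option, with revenues $r_1,\ldots,r_N>0$ and $r_{N+1}=0$. There are $K$ rankings; for each $k\in[K]$, $i_{k,1},\ldots,i_{k,N+1}$ is a permutation of $[N+1]$ listing the products from most to least preferred by ranking $k$. $L_k$ is the number of products preferred to the no-purchase option by ranking $k$, so $i_{k,L_k+1}=N+1$; it is assumed that $L_k\ge1$ for all $k$. Let $\mathcal{X}^c=\{\mathbf{x}\in[0,1]^{N+1}: x_{N+1}=1\}$. Let $\mathcal{R}_k=\{r_{i_{k,\ell}}:\ell\in\{1,\ldots,L_k+1\}\}$ and $\bar r_k=\max\mathcal{R}_k$. Let $$\Delta_k=\{\boldsymbol{\delta}\in\mathbb{R}^{L_k+1}: 0\le\delta_1\le\cdots\le\delta_{L_k+1}\le\bar r_k\},$$ $$J_k(\mathbf{x},\boldsymbol{\delta})=\delta_{L_k+1}+\sum_{\ell=1}^{L_k}\left(\max\{0,r_{i_{k,\ell}}-\delta_\ell\}-(\delta_{\ell+1}-\delta_\ell)\right)x_{i_{k,\ell}}.$$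 $\boldsymbol{\delta}\in\Delta_k$ dominates $\boldsymbol{\delta}'\in\Delta_k$ if $J_k(\mathbf{x},\boldsymbol{\delta})\le J_k(\mathbf{x},\boldsymbol{\delta}')$ for all $\mathbf{x}\in\mathcal{X}^c$, with strict inequality at some $\bar{\mathbf{x}}\in\mathcal{X}^c$; $\boldsymbol{\delta}\in\Delta_k$ is a Pareto cut if no $\boldsymbol{\delta}'\in\Delta_k$ dominates it. For $\boldsymbol{\delta}\in\Delta_k$, $T_k(\boldsymbol{\delta})=\max\{L\in\{1,\ldots,L_k+1\}:\delta_L\le r_{i_{k,L}}\}$ (this set is always nonempty). *)

theory Defs
  imports Complex_Main "HOL-Library.FuncSet"
begin

text \<open>
  Products are the numbers \<open>1, \<dots>, N + 1\<close>, product \<open>N + 1\<close> being the no-purchase option.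
  A ranking is a function \<open>s\<close> whose restriction to \<open>{1..N + 1}\<close> is a permutation of
  \<open>{1..N + 1}\<close>; \<open>s l\<close> is the \<open>l\<close>-th most preferred product.  A family of
  rankings \<open>i\<close> has \<open>i k l\<close> for \<open>i\<^sub>k\<^sub>,\<^sub>l\<close>, and the definitions below are applied
  to \<open>s = i k\<close>.  Vectors indexed from 1 are extensional functions on the index set, so that
  two vectors are equal iff their components are.
\<close>

definition prefers :: "nat \<Rightarrow> (nat \<Rightarrow> nat) \<Rightarrow> nat \<Rightarrow> nat \<Rightarrow> bool" where
  "prefers N s a b \<longleftrightarrow> (\<exists>l\<in>{1..N + 1}. \<exists>m\<in>{1..N + 1}. l < m \<and> s l = a \<and> s m = b)"

definition num_pref :: "nat \<Rightarrow> (nat \<Rightarrow> nat) \<Rightarrow> nat" where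
  "num_pref N s = card {j \<in> {1..N + 1}. prefers N s j (N + 1)}"

definition assortments :: "nat \<Rightarrow> (nat \<Rightarrow> real) set" where
  "assortments N = {x \<in> {1..N + 1} \<rightarrow>\<^sub>E {0..1}. x (N + 1) = 1}"

definition max_rev :: "nat \<Rightarrow> (nat \<Rightarrow> real) \<Rightarrow> (nat \<Rightarrow> nat) \<Rightarrow> real" where
  "max_rev N r s = Max {r (s l) | l. l \<in> {1..num_pref N s + 1}}"

definition cuts :: "nat \<Rightarrow> (nat \<Rightarrow> real) \<Rightarrow> (nat \<Rightarrow> nat) \<Rightarrow> (nat \<Rightarrow> real) set" where
  "cuts N r s = {d \<in> {1..num_pref N s + 1} \<rightarrow>\<^sub>E UNIV.
     0 \<le> d 1 \<and> (\<forall>l\<in>{1..num_pref N s}. d l \<le> d (l + 1)) \<and>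
     d (num_pref N s + 1) \<le> max_rev N r s}"

definition cut_value ::
  "nat \<Rightarrow> (nat \<Rightarrow> real) \<Rightarrow> (nat \<Rightarrow> nat) \<Rightarrow> (nat \<Rightarrow> real) \<Rightarrow> (nat \<Rightarrow> real) \<Rightarrow> real" where
  "cut_value N r s x d = d (num_pref N s + 1) +
     (\<Sum>l = 1..num_pref N s. (max 0 (r (s l) - d l) - (d (l + 1) - d l)) * x (s l))"

definition dominates ::
  "nat \<Rightarrow> (nat \<Rightarrow> real) \<Rightarrow> (nat \<Rightarrow> nat) \<Rightarrow> (nat \<Rightarrow> real) \<Rightarrow> (nat \<Rightarrow> real) \<Rightarrow> bool" where
  "dominates N r s d d' \<longleftrightarrow>
     (\<forall>x\<in>assortments N. cut_value N r s x d \<le> cut_value N r s x d') \<and>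
     (\<exists>x\<in>assortments N. cut_value N r s x d < cut_value N r s x d')"

definition pareto_cut ::
  "nat \<Rightarrow> (nat \<Rightarrow> real) \<Rightarrow> (nat \<Rightarrow> nat) \<Rightarrow> (nat \<Rightarrow> real) \<Rightarrow> bool" where
  "pareto_cut N r s d \<longleftrightarrow> d \<in> cuts N r s \<and> \<not> (\<exists>d'\<in>cuts N r s. dominates N r s d' d)"

definition last_below :: "nat \<Rightarrow> (nat \<Rightarrow> real) \<Rightarrow> (nat \<Rightarrow> nat) \<Rightarrow> (nat \<Rightarrow> real) \<Rightarrow> nat" where
  "last_below N r s d = Max {l \<in> {1..num_pref N s + 1}. d l \<le> r (s l)}"

lemma num_pref_no_purchase:
  assumes "bij_betw s {1..N + 1} {1..N + 1}"
  shows "num_pref N s + 1 \<in> {1..N + 1}" and "s (num_pref N s + 1) = N + 1"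
proof -
  have inj: "inj_on s {1..N + 1}" and im: "s ` {1..N + 1} = {1..N + 1}"
    using assms by (auto simp: bij_betw_def)
  have "N + 1 \<in> s ` {1..N + 1}"
    unfolding im by simp
  then obtain m where m: "m \<in> {1..N + 1}" "s m = N + 1"
    by (metis imageE)
  have "{j \<in> {1..N + 1}. prefers N s j (N + 1)} = s ` {1..<m}"
  proof (intro equalityI subsetI)
    fix j
    assume "j \<in> {j \<in> {1..N + 1}. prefers N s j (N + 1)}"
    then obtain l m' where l: "l \<in> {1..N + 1}" "m' \<in> {1..N + 1}" "l < m'" "s l = j" "s m' = N + 1"
      unfolding prefers_def by blast
    have "m' = m"
      using inj_onD[OF inj, of m' m] l m by simp
    then show "j \<in> s ` {1..<m}"
      using l by auto
  next
    fix j
    assume "j \<in> s ` {1..<m}"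
    then obtain l where l: "l \<in> {1..<m}" "j = s l" by blast
    have l': "l \<in> {1..N + 1}" "l < m"
      using l m by auto
    moreover have "j \<in> {1..N + 1}"
      using im l' l by blast
    ultimately show "j \<in> {j \<in> {1..N + 1}. prefers N s j (N + 1)}"
      unfolding prefers_def using m l by blast
  qed
  moreover have "inj_on s {1..<m}"
    by (rule inj_on_subset[OF inj]) (use m in auto)
  ultimately have "num_pref N s = m - 1"
    by (simp add: num_pref_def card_image)
  then have "num_pref N s + 1 = m"
    using m by simp
  then show "num_pref N s + 1 \<in> {1..N + 1}" "s (num_pref N s + 1) = N + 1"
    using m by simp_all
qed

lemma last_below_set_nonempty:
  assumes "d \<in> cuts N r s"
  shows "{l \<in> {1..num_pref N s + 1}. d l \<le> r (s l)} \<noteq> {}"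
proof -
  let ?n = "num_pref N s"
  have mono: "d l \<le> d (?n + 1)" if "l \<le> ?n + 1" "1 \<le> l" for l
    using that
  proof (induction rule: inc_induct)
    case (step m)
    have "d m \<le> d (m + 1)"
      using assms step by (auto simp: cuts_def)
    then show ?case
      using step by simp
  qed simp
  have eq: "{r (s l) | l. l \<in> {1..?n + 1}} = (\<lambda>l. r (s l)) ` {1..?n + 1}"
    by blast
  have "max_rev N r s \<in> (\<lambda>l. r (s l)) ` {1..?n + 1}"
    unfolding max_rev_def eq by (rule Max_in) auto
  then obtain l where l: "l \<in> {1..?n + 1}" "max_rev N r s = r (s l)" by blast
  have "d l \<le> d (?n + 1)"
    using mono l by simp
  also have "\<dots> \<le> r (s l)"
    using assms l by (simp add: cuts_def)
  finally show ?thesis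
    using l by blast
qed

end

theory Submission
  imports Defs
begin

text \<open>
  Write \<open>c\<^sub>l = max \<delta>\<^sub>l r\<^sub>l - \<delta>\<^sub>l\<^sub>+\<^sub>1\<close> for the coefficient of the \<open>l\<close>-th preferred product in the
  cut of \<open>\<delta>\<close>, where \<open>r\<^sub>l\<close> is the revenue of that product and \<open>n = L\<^sub>k\<close>.  Let \<open>\<delta>'\<close> be a cut
  whose value exceeds that of \<open>\<delta>\<close> at no assortment, let \<open>c'\<close> be its coefficients, and put
  \<open>\<epsilon>\<^sub>l = \<delta>\<^sub>l - \<delta>'\<^sub>l\<close> and \<open>T = T\<^sub>k(\<delta>)\<close>.  The empty assortment gives \<open>\<epsilon>\<^sub>n\<^sub>+\<^sub>1 \<ge> 0\<close>, and since \<open>\<delta>\<close>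
  is constant from \<open>T\<close> on while \<open>\<delta>'\<close> increases, \<open>\<epsilon>\<close> is nonnegative and decreasing from \<open>T\<close> on.

  The product at position \<open>T\<close> is what makes the other inequalities tight.  As
  \<open>\<delta>'\<^sub>T \<le> \<delta>\<^sub>T \<le> r\<^sub>T\<close>, offering it changes the value of \<open>\<delta>\<close> minus that of \<open>\<delta>'\<close> by
  \<open>- \<epsilon>\<^sub>T\<^sub>+\<^sub>1 \<le> - \<epsilon>\<^sub>n\<^sub>+\<^sub>1\<close>, so no slack is left, and adding the product at a position \<open>l < T\<close>
  must not decrease this difference: \<open>c'\<^sub>l \<le> c\<^sub>l\<close> for all \<open>l < T\<close>.  (If \<open>T = n + 1\<close>, the
  no-purchase revenue \<open>0\<close> bounds \<open>\<delta>\<^sub>n\<^sub>+\<^sub>1\<close> from above, and there is no slack to begin with.)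

  At a position \<open>2 \<le> l < T\<close> this yields \<open>\<epsilon>\<^sub>l \<ge> \<epsilon>\<^sub>l\<^sub>+\<^sub>1\<close>: directly if \<open>r\<^sub>l \<le> \<delta>\<^sub>l\<close>, and otherwise
  because the third property makes \<open>\<delta>\<close> flat at \<open>l\<close>.  Hence \<open>\<epsilon>\<^sub>2\<close> is an upper bound for all later
  \<open>\<epsilon>\<^sub>l\<close>, which are nonnegative.  At position \<open>1\<close> the bound \<open>\<delta>\<^sub>1 \<le> r\<^sub>1\<close> turns
  \<open>c'\<^sub>1 \<le> c\<^sub>1\<close> into \<open>\<epsilon>\<^sub>2 \<le> 0\<close>.  So \<open>\<delta>\<close> and \<open>\<delta>'\<close> agree from position \<open>2\<close> on and
  \<open>c'\<^sub>1 = c\<^sub>1\<close>; the two cuts are the same function, and \<open>\<delta>'\<close> does not dominate \<open>\<delta>\<close>.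
\<close>

definition cut_coeff :: "(nat \<Rightarrow> real) \<Rightarrow> (nat \<Rightarrow> real) \<Rightarrow> nat \<Rightarrow> real" where
  "cut_coeff \<rho> d l = max (d l) (\<rho> l) - d (l + 1)"

lemma cut_value_cut_coeff:
  "cut_value N r s x d = d (num_pref N s + 1) +
     (\<Sum>l = 1..num_pref N s. cut_coeff (r \<circ> s) d l * x (s l))"
proof -
  have "max 0 (r (s l) - d l) - (d (l + 1) - d l) = cut_coeff (r \<circ> s) d l" for l
    by (simp add: cut_coeff_def max_def)
  then show ?thesis
    by (simp add: cut_value_def)
qed

text \<open>
  A ranking lists the products injectively, so every set of positions before the no-purchase
  option can be offered separately; cuts may thus be compared position by position.
\<close>

lemma exists_assortment_offering:
  assumes bij: "bij_betw s {1..N + 1} {1..N + 1}"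
    and S: "S \<subseteq> {1..num_pref N s}"
  shows "\<exists>x\<in>assortments N. \<forall>d.
    cut_value N r s x d = d (num_pref N s + 1) + (\<Sum>l\<in>S. cut_coeff (r \<circ> s) d l)"
proof
  let ?n = "num_pref N s"
  let ?x = "\<lambda>j\<in>{1..N + 1}. if j \<in> insert (N + 1) (s ` S) then 1 else (0::real)"
  show "?x \<in> assortments N"
    by (auto simp: assortments_def)
  note last = num_pref_no_purchase[OF bij]
  have pos: "s l \<in> {1..N + 1}" "s l \<noteq> N + 1" "s l \<in> s ` S \<longleftrightarrow> l \<in> S" if "l \<in> {1..?n}" for l
  proof -
    have inj: "inj_on s {1..N + 1}"
      using bij by (simp add: bij_betw_def)
    have l: "l \<in> {1..N + 1}"
      using that last(1) by auto
    show "s l \<in> {1..N + 1}"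
      using bij_betwE[OF bij] l by blast
    show "s l \<noteq> N + 1"
    proof
      assume "s l = N + 1"
      then have "l = ?n + 1"
        using inj_onD[OF inj, of l "?n + 1"] l last by simp
      with that show False by simp
    qed
    have "S \<subseteq> {1..N + 1}"
      using S last(1) by fastforce
    then show "s l \<in> s ` S \<longleftrightarrow> l \<in> S"
      using inj_on_image_mem_iff[OF inj l] by blast
  qed
  have "(\<Sum>l = 1..?n. cut_coeff (r \<circ> s) d l * ?x (s l)) = (\<Sum>l\<in>S. cut_coeff (r \<circ> s) d l)" for d
  proof -
    have "(\<Sum>l = 1..?n. cut_coeff (r \<circ> s) d l * ?x (s l))
        = (\<Sum>l = 1..?n. if l \<in> S then cut_coeff (r \<circ> s) d l else 0)"
      by (rule sum.cong) (use pos in auto)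
    also have "\<dots> = (\<Sum>l\<in>S. cut_coeff (r \<circ> s) d l)"
      using S by (simp add: sum.If_cases Int_absorb1)
    finally show ?thesis .
  qed
  then show "\<forall>d. cut_value N r s ?x d = d (?n + 1) + (\<Sum>l\<in>S. cut_coeff (r \<circ> s) d l)"
    by (simp only: cut_value_cut_coeff) simp
qed

lemma cuts_mono:
  assumes "d \<in> cuts N r s" "1 \<le> l" "l \<le> m" "m \<le> num_pref N s + 1"
  shows "d l \<le> d m"
  using assms(3,2,4)
proof (induction rule: dec_induct)
  case (step p)
  have "d p \<le> d (p + 1)"
    using assms(1) step by (auto simp: cuts_def)
  then show ?case
    using step by simp
qed simp

lemma cuts_nonneg:
  assumes "d \<in> cuts N r s" "1 \<le> l" "l \<le> num_pref N s + 1"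
  shows "0 \<le> d l"
  using cuts_mono[of d N r s 1 l] assms by (auto simp: cuts_def)

text \<open>
  The comparison of the two sequences, freed from rankings: testing sets of at most two
  positions forces the
  coefficients to agree.  The hypothesis on \<open>d' (n + 1)\<close> stands for the vanishing revenue
  of the no-purchase option, which takes over the part of position \<open>T\<close> when \<open>T = n + 1\<close>.
\<close>

lemma below_tight_cut_eq:
  fixes d d' \<rho> :: "nat \<Rightarrow> real"
  assumes le: "\<And>S. S \<subseteq> {1..n} \<Longrightarrow>
      d' (n + 1) + (\<Sum>l\<in>S. cut_coeff \<rho> d' l) \<le> d (n + 1) + (\<Sum>l\<in>S. cut_coeff \<rho> d l)"
    and mono': "\<And>l m. 1 \<le> l \<Longrightarrow> l \<le> m \<Longrightarrow> m \<le> n + 1 \<Longrightarrow> d' l \<le> d' m"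
    and last: "\<rho> (n + 1) \<le> d' (n + 1)"
    and T: "1 < T" "T \<le> n + 1" "d T \<le> \<rho> T"
    and first: "d 1 \<le> \<rho> 1"
    and flat: "\<And>l. 2 \<le> l \<Longrightarrow> l \<le> n \<Longrightarrow> d l < \<rho> l \<Longrightarrow> d l = d (l + 1)"
    and const: "\<And>l. T \<le> l \<Longrightarrow> l \<le> n + 1 \<Longrightarrow> d l = d (n + 1)"
  shows "d' (n + 1) = d (n + 1)"
    and "\<And>l. 1 \<le> l \<Longrightarrow> l \<le> n \<Longrightarrow> cut_coeff \<rho> d' l = cut_coeff \<rho> d l"
proof -
  have end_le: "d' (n + 1) \<le> d (n + 1)"
    using le[of "{}"] by simp
  have tail_le: "d' l \<le> d l" if "T \<le> l" "l \<le> n + 1" for l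
    using mono'[of l "n + 1"] const[OF that] end_le that T(1) by simp
  have coeff_le: "cut_coeff \<rho> d' l \<le> cut_coeff \<rho> d l" if l: "1 \<le> l" "l < T" for l
  proof (cases "T \<le> n")
    case True
    have "cut_coeff \<rho> d T - cut_coeff \<rho> d' T = d' (T + 1) - d (T + 1)"
      using tail_le[of T] T by (simp add: cut_coeff_def)
    also have "\<dots> \<le> d' (n + 1) - d (n + 1)"
      using mono'[of "T + 1" "n + 1"] const[of "T + 1"] True by simp
    finally show ?thesis
      using le[of "{l, T}"] True l by simp
  next
    case False
    then have "T = n + 1"
      using T(2) by simp
    then have "d (n + 1) \<le> d' (n + 1)"
      using T(3) last by simp
    then show ?thesis
      using le[of "{l}"] \<open>T = n + 1\<close> l by simp
  qed
  have gap_step: "d (l + 1) - d' (l + 1) \<le> d l - d' l" if l: "2 \<le> l" "l \<le> n" for l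
  proof (cases "l < T \<and> \<rho> l \<le> d l")
    case True
    then show ?thesis
      using coeff_le[of l] l by (simp add: cut_coeff_def)
  next
    case False
    have "d l = d (l + 1)"
    proof (cases "l < T")
      case True
      then show ?thesis
        using False flat[OF l] by simp
    next
      case False
      then show ?thesis
        using const[of l] const[of "l + 1"] l by simp
    qed
    then show ?thesis
      using mono'[of l "l + 1"] l by simp
  qed
  have gap_le: "d m - d' m \<le> d l - d' l" if "l \<le> m" "2 \<le> l" "m \<le> n + 1" for l m
    using that
  proof (induction rule: dec_induct)
    case (step p)
    then show ?case
      using gap_step[of p] by simp
  qed simp
  have "d 2 - d' 2 \<le> 0"
    using coeff_le[of 1] first T(1) by (simp add: cut_coeff_def numeral_2_eq_2)
  then have eq: "d' l = d l" if "2 \<le> l" "l \<le> n + 1" for l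
    using gap_le[of 2 l] gap_le[of l "n + 1"] end_le that by simp
  show "d' (n + 1) = d (n + 1)"
    using eq[of "n + 1"] T by simp
  show "cut_coeff \<rho> d' l = cut_coeff \<rho> d l" if l: "1 \<le> l" "l \<le> n" for l
  proof (cases "l = 1")
    case True
    \<comment> \<open>The values at position \<open>1\<close> may differ, but both lie below the revenue there, which is
      all that the coefficient sees.\<close>
    have "d' 2 = d 2"
      using eq l True by simp
    then show ?thesis
      using coeff_le[of 1] first T(1) True by (simp add: cut_coeff_def numeral_2_eq_2)
  next
    case False
    then show ?thesis
      using eq[of l] eq[of "l + 1"] l by (simp add: cut_coeff_def)
  qed
qed

theorem theorem4:
  fixes N K k :: nat
    and r :: "nat \<Rightarrow> real"
    and i :: "nat \<Rightarrow> nat \<Rightarrow> nat"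
    and \<delta> :: "nat \<Rightarrow> real"
  assumes "\<forall>j\<in>{1..N}. r j > 0"
    and "r (N + 1) = 0"
    and "\<forall>k\<in>{1..K}. bij_betw (i k) {1..N + 1} {1..N + 1}"
    and "\<forall>k\<in>{1..K}. num_pref N (i k) \<ge> 1"
    and "k \<in> {1..K}"
    and "\<delta> \<in> cuts N r (i k)"
    and "last_below N r (i k) \<delta> > 1"
    and "\<delta> 1 \<le> r (i k 1)"
    and "\<forall>l\<in>{2..num_pref N (i k)}. \<delta> l < r (i k l) \<longrightarrow> \<delta> l = \<delta> (l + 1)"
    and "\<forall>l\<in>{last_below N r (i k) \<delta>..num_pref N (i k) + 1}. \<delta> l = \<delta> (num_pref N (i k) + 1)"
  shows "pareto_cut N r (i k) \<delta>"
proof -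
  let ?s = "i k" and ?n = "num_pref N (i k)" and ?T = "last_below N r (i k) \<delta>"
  have bij: "bij_betw ?s {1..N + 1} {1..N + 1}"
    using assms(3,5) by blast
  have T: "?T \<in> {l \<in> {1..?n + 1}. \<delta> l \<le> r (?s l)}"
    unfolding last_below_def
    by (rule Max_in[OF _ last_below_set_nonempty[OF assms(6)]]) simp
  have "\<not> dominates N r ?s d' \<delta>" if d': "d' \<in> cuts N r ?s" for d'
  proof
    assume dom: "dominates N r ?s d' \<delta>"
    have le: "d' (?n + 1) + (\<Sum>l\<in>S. cut_coeff (r \<circ> ?s) d' l)
        \<le> \<delta> (?n + 1) + (\<Sum>l\<in>S. cut_coeff (r \<circ> ?s) \<delta> l)" if S: "S \<subseteq> {1..?n}" for S
    proof -
      obtain x where x: "x \<in> assortments N" and val: "\<forall>d. cut_value N r ?s x d =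
          d (?n + 1) + (\<Sum>l\<in>S. cut_coeff (r \<circ> ?s) d l)"
        using exists_assortment_offering[OF bij S] by (rule bexE)
      have "cut_value N r ?s x d' \<le> cut_value N r ?s x \<delta>"
        using dom x by (simp only: dominates_def)
      then show ?thesis
        by (simp only: val)
    qed
    have last: "(r \<circ> ?s) (?n + 1) \<le> d' (?n + 1)"
      using num_pref_no_purchase(2)[OF bij] assms(2) cuts_nonneg[OF d', of "?n + 1"] by simp
    have T_tight: "?T \<le> ?n + 1" "\<delta> ?T \<le> (r \<circ> ?s) ?T"
      using T by simp_all
    have first: "\<delta> 1 \<le> (r \<circ> ?s) 1"
      using assms(8) by simp
    have flat: "\<delta> l = \<delta> (l + 1)" if "2 \<le> l" "l \<le> ?n" "\<delta> l < (r \<circ> ?s) l" for l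
      by (rule assms(9)[rule_format]) (use that in simp_all)
    have const: "\<delta> l = \<delta> (?n + 1)" if "?T \<le> l" "l \<le> ?n + 1" for l
      by (rule assms(10)[rule_format]) (use that in simp)
    have mono': "d' l \<le> d' m" if "1 \<le> l" "l \<le> m" "m \<le> ?n + 1" for l m
      using cuts_mono[OF d' that] .
    note tight_cut = le mono' last assms(7) T_tight first flat const
    have end_eq: "d' (?n + 1) = \<delta> (?n + 1)"
      by (rule below_tight_cut_eq(1)[where \<rho> = "r \<circ> ?s" and T = ?T]) (fact tight_cut)+
    have coeff_eq: "cut_coeff (r \<circ> ?s) d' l = cut_coeff (r \<circ> ?s) \<delta> l"
      if l: "1 \<le> l" "l \<le> ?n" for l
      by (rule below_tight_cut_eq(2)[where n = ?n and T = ?T]) (fact tight_cut l)+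
    have "cut_value N r ?s x d' = cut_value N r ?s x \<delta>" for x
      unfolding cut_value_cut_coeff end_eq by (simp add: coeff_eq)
    then show False
      using dom by (simp add: dominates_def)
  qed
  then show ?thesis
    using assms(6) by (auto simp: pareto_cut_def)
qed

end
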